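(* Consider the 2-person non-initialized game $(\mathcal{G}_2,u)$ under the Markov realization. If the payoff $u$ satisfies $$u_1(c)>u_1(a_1)>u_1(a_2),\qquad u_2(a_1)>u_2(a_2)>u_2(c),$$ then $(\mathcal{G}_2,u)$ has no uniform Nash equilibrium in mixed strategies.
   Context: Game structure $\mathcal{G}_2$: the directed graph has non-terminal positions $v_1,v_2$, terminal positions $a_1,a_2$, and arcs $(v_1,v_2),(v_2,v_1),(v_1,a_1),(v_2,a_2)$. Player $i\in\{1,2\}$ controls $v_i$. The outcomes are $a_1,a_2$ (termination there) and $c$ (infinite play). A payoff is $u:\{1,2\}\times\{a_1,a_2,c\}\to\mathbb{R}$, written $u_i(a)$. A mixed strategy of player $i$ is a number $p_i\in[0,1]$: the probability of following the cycle (moving to the other non-terminal position); with probability $1-p_i$ the player moves to $a_i$. Under the Markov realization the move is drawn afresh and independently each time a position is visited. Thus if $p_1=p_2=1$ the outcome is $c$ with probability 1 from either initial position; otherwise the distribution on $(a_1,a_2,c)$ is $\left(\frac{1-p_1}{1-p_1p_2},\frac{p_1(1-p_2)}{1-p_1p_2},0\right)$ for initial position $v_1$ and $\left(\frac{p_2(1-p_1)}{1-p_1p_2},\frac{1-p_2}{1-p_1p_2},0\right)$ for initial position $v_2$. Player $i$'s expected payoff is the corresponding expectation of $u_i$. A pair $(p_1,p_2)\in[0,1]^2$ is a uniform Nash equilibrium (UNE) if for each initial position $v_j$, $j=1,2$, no player can strictly increase his expected payoff by changing only his own $p_i\in[0,1]$. *)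

theory Defs
  imports "HOL-Probability.Probability"
begin

datatype player = P1 | P2

datatype position = V1 | V2 | A1 | A2

datatype outcome = End_A1 | End_A2 | Cycle

type_synonym payoff = "player \<Rightarrow> outcome \<Rightarrow> real"

text \<open>The component \<open>p i\<close> is the probability with which player \<open>i\<close> follows the cycle.\<close>

type_synonym profile = "player \<Rightarrow> real"

definition nonterminals :: "position set" where
  "nonterminals = {V1, V2}"

definition arcs :: "(position \<times> position) set" where
  "arcs = {(V1, V2), (V2, V1), (V1, A1), (V2, A2)}"

text \<open>
  A draw contains one potential decision per player, with \<open>True\<close> meaning to follow the cycle;
  only the decision of the player who controls the current position is used. Terminal
  positions are made absorbing, so that every play is an infinite sequence.
\<close>

fun step :: "bool \<times> bool \<Rightarrow> position \<Rightarrow> position" where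
  "step (b1, b2) V1 = (if b1 then V2 else A1)"
| "step (b1, b2) V2 = (if b2 then V1 else A2)"
| "step (b1, b2) A1 = A1"
| "step (b1, b2) A2 = A2"

lemma step_arcs:
  assumes "x \<in> nonterminals"
  shows "(x, y) \<in> arcs \<longleftrightarrow> (\<exists>d. step d x = y)"
proof -
  have "(\<exists>d. step d x = y) \<longleftrightarrow>
      step (True, True) x = y \<or> step (True, False) x = y \<or>
      step (False, True) x = y \<or> step (False, False) x = y"
    by (simp only: split_paired_Ex ex_bool_eq disj_assoc)
  then show ?thesis
    using assms by (cases x; cases y) (simp_all add: nonterminals_def arcs_def)
qed

primrec play :: "position \<Rightarrow> (bool \<times> bool) stream \<Rightarrow> nat \<Rightarrow> position" where
  "play x \<omega> 0 = x"
| "play x \<omega> (Suc n) = step (\<omega> !! n) (play x \<omega> n)"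

definition outcome :: "position \<Rightarrow> (bool \<times> bool) stream \<Rightarrow> outcome" where
  "outcome x \<omega> =
    (if \<exists>n. play x \<omega> n = A1 then End_A1
     else if \<exists>n. play x \<omega> n = A2 then End_A2
     else Cycle)"

text \<open>
  Markov realization: time \<open>n\<close> uses the \<open>n\<close>-th of a sequence of independent, identically
  distributed draws, so each visit to a position uses a fresh independent decision.
\<close>

definition draws :: "profile \<Rightarrow> (bool \<times> bool) stream measure" where
  "draws p = stream_space (measure_pmf (pair_pmf (bernoulli_pmf (p P1)) (bernoulli_pmf (p P2))))"

definition outcome_prob :: "profile \<Rightarrow> position \<Rightarrow> outcome \<Rightarrow> real" where
  "outcome_prob p x r = \<P>(\<omega> in draws p. outcome x \<omega> = r)"

definition expected_payoff :: "payoff \<Rightarrow> profile \<Rightarrow> position \<Rightarrow> player \<Rightarrow> real" where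
  "expected_payoff u p x i = (\<integral>\<omega>. u i (outcome x \<omega>) \<partial>draws p)"

definition is_profile :: "profile \<Rightarrow> bool" where
  "is_profile p \<longleftrightarrow> (\<forall>i. p i \<in> {0..1})"

definition uniform_Nash_equilibrium :: "payoff \<Rightarrow> profile \<Rightarrow> bool" where
  "uniform_Nash_equilibrium u p \<longleftrightarrow>
    is_profile p \<and>
    (\<forall>x \<in> nonterminals. \<forall>i. \<forall>q \<in> {0..1}.
      expected_payoff u (p(i := q)) x i \<le> expected_payoff u p x i)"


lemma play_Suc_shift: "play x \<omega> (Suc n) = play (step (shd \<omega>) x) (stl \<omega>) n"
  by (induction n) auto

lemma play_A1 [simp]: "play A1 \<omega> n = A1"
proof (induction n)
  case (Suc n) then show ?case by (cases "\<omega> !! n") auto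
qed simp

lemma play_A2 [simp]: "play A2 \<omega> n = A2"
proof (induction n)
  case (Suc n) then show ?case by (cases "\<omega> !! n") auto
qed simp

lemma outcome_A1 [simp]: "outcome A1 \<omega> = End_A1"
  by (simp add: outcome_def)

lemma outcome_A2 [simp]: "outcome A2 \<omega> = End_A2"
  by (simp add: outcome_def)

lemma outcome_step:
  assumes "x \<in> nonterminals"
  shows "outcome x \<omega> = outcome (step (shd \<omega>) x) (stl \<omega>)"
proof -
  have *: "(\<exists>n. play x \<omega> n = y) \<longleftrightarrow> (\<exists>n. play (step (shd \<omega>) x) (stl \<omega>) n = y)"
    if y: "y \<notin> nonterminals" for y
  proof
    assume "\<exists>n. play x \<omega> n = y"
    then obtain n where n: "play x \<omega> n = y" by blast
    then obtain m where "n = Suc m" using assms y by (cases n) auto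
    with n have "play (step (shd \<omega>) x) (stl \<omega>) m = y"
      by (simp only: play_Suc_shift)
    then show "\<exists>n. play (step (shd \<omega>) x) (stl \<omega>) n = y" ..
  next
    assume "\<exists>n. play (step (shd \<omega>) x) (stl \<omega>) n = y"
    then obtain n where "play (step (shd \<omega>) x) (stl \<omega>) n = y" ..
    then have "play x \<omega> (Suc n) = y"
      by (simp only: play_Suc_shift)
    then show "\<exists>n. play x \<omega> n = y" ..
  qed
  have "A1 \<notin> nonterminals" "A2 \<notin> nonterminals"
    by (simp_all add: nonterminals_def)
  then show ?thesis
    by (simp only: outcome_def * not_False_eq_True)
qed

lemma prob_space_draws: "prob_space (draws p)"
  unfolding draws_def
  by (intro prob_space.prob_space_stream_space measure_pmf.prob_space_axioms)

lemma measurable_play: "(\<lambda>\<omega>. play x \<omega> n) \<in> measurable (draws p) (count_space UNIV)"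
proof (induction n)
  case (Suc n)
  let ?D = "measure_pmf (pair_pmf (bernoulli_pmf (p P1)) (bernoulli_pmf (p P2)))"
  have "(\<lambda>\<omega>. \<omega> !! n) \<in> measurable (draws p) ?D"
    unfolding draws_def by measurable
  moreover have "measurable (draws p) ?D = measurable (draws p) (count_space UNIV)"
    by (intro measurable_cong_sets) auto
  ultimately have d: "(\<lambda>\<omega>. \<omega> !! n) \<in> measurable (draws p) (count_space UNIV)"
    by simp
  have "(\<lambda>\<omega>. step d (play x \<omega> n)) \<in> measurable (draws p) (count_space UNIV)" for d
    by (rule measurable_compose[OF Suc]) simp
  then have "(\<lambda>\<omega>. step (\<omega> !! n) (play x \<omega> n)) \<in> measurable (draws p) (count_space UNIV)"
    by (rule measurable_compose_countable[OF _ d])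
  then show ?case by simp
qed simp

lemma measurable_outcome: "outcome x \<in> measurable (draws p) (count_space UNIV)"
proof -
  note [measurable] = measurable_play
  have "(\<lambda>\<omega>. outcome x \<omega>) \<in> measurable (draws p) (count_space UNIV)"
    unfolding outcome_def by measurable
  then show ?thesis by simp
qed

lemma outcome_prob_terminal [simp]:
  "outcome_prob p A1 r = (if r = End_A1 then 1 else 0)"
  "outcome_prob p A2 r = (if r = End_A2 then 1 else 0)"
  using prob_space.prob_space[OF prob_space_draws, of p]
  by (auto simp: outcome_prob_def)

lemma outcome_prob_step:
  assumes "x \<in> nonterminals" "is_profile p"
  shows "outcome_prob p x r =
    p P1 * p P2 * outcome_prob p (step (True, True) x) r +
    p P1 * (1 - p P2) * outcome_prob p (step (True, False) x) r +
    (1 - p P1) * p P2 * outcome_prob p (step (False, True) x) r +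
    (1 - p P1) * (1 - p P2) * outcome_prob p (step (False, False) x) r"
proof -
  let ?D = "pair_pmf (bernoulli_pmf (p P1)) (bernoulli_pmf (p P2))"
  have p: "0 \<le> p P1" "p P1 \<le> 1" "0 \<le> p P2" "p P2 \<le> 1"
    using assms(2) by (auto simp: is_profile_def)
  have nn: "0 \<le> outcome_prob p y r" for y
    by (simp add: outcome_prob_def)
  have sets: "{\<omega> \<in> space (draws p). outcome x \<omega> = r} \<in> sets (draws p)"
    using measurable_outcome by measurable
  have "ennreal (outcome_prob p x r) =
      (\<integral>\<^sup>+t. \<P>(\<omega> in draws p. outcome x (t ## \<omega>) = r) \<partial>measure_pmf ?D)"
    unfolding outcome_prob_def draws_def
    by (rule prob_space.prob_stream_space[OF measure_pmf.prob_space_axioms])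
       (use sets in \<open>simp add: draws_def\<close>)
  also have "\<dots> = (\<integral>\<^sup>+t. outcome_prob p (step t x) r \<partial>measure_pmf ?D)"
    using outcome_step[OF assms(1)] by (simp add: outcome_prob_def)
  also have "\<dots> = ennreal (
    p P1 * p P2 * outcome_prob p (step (True, True) x) r +
    p P1 * (1 - p P2) * outcome_prob p (step (True, False) x) r +
    (1 - p P1) * p P2 * outcome_prob p (step (False, True) x) r +
    (1 - p P1) * (1 - p P2) * outcome_prob p (step (False, False) x) r)"
  proof -
    define f where "f t = outcome_prob p (step t x) r" for t
    have f: "0 \<le> f t" for t by (simp add: f_def nn)
    have "(\<integral>\<^sup>+t. ennreal (f t) \<partial>measure_pmf ?D) =
        (\<integral>\<^sup>+b1. ennreal (f (b1, True) * p P2 + f (b1, False) * (1 - p P2))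
          \<partial>measure_pmf (bernoulli_pmf (p P1)))"
      unfolding nn_integral_pair_pmf' using p f
      by (intro nn_integral_cong) (simp add: ennreal_mult)
    also have "\<dots> = ennreal (
        (f (True, True) * p P2 + f (True, False) * (1 - p P2)) * p P1 +
        (f (False, True) * p P2 + f (False, False) * (1 - p P2)) * (1 - p P1))"
      using p f by (simp add: ennreal_mult)
    also have "(f (True, True) * p P2 + f (True, False) * (1 - p P2)) * p P1 +
        (f (False, True) * p P2 + f (False, False) * (1 - p P2)) * (1 - p P1) =
        p P1 * p P2 * f (True, True) + p P1 * (1 - p P2) * f (True, False) +
        (1 - p P1) * p P2 * f (False, True) + (1 - p P1) * (1 - p P2) * f (False, False)"
      by algebra
    finally show ?thesis
      unfolding f_def .
  qed
  finally show ?thesis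
    using p nn by (subst (asm) ennreal_inj)
      (simp_all del: step.simps)
qed

lemma outcome_prob_V1:
  assumes "is_profile p"
  shows "outcome_prob p V1 r =
    p P1 * outcome_prob p V2 r + (1 - p P1) * (if r = End_A1 then 1 else 0)"
  using outcome_prob_step[OF _ assms, of V1 r] by (simp add: nonterminals_def algebra_simps)

lemma outcome_prob_V2:
  assumes "is_profile p"
  shows "outcome_prob p V2 r =
    p P2 * outcome_prob p V1 r + (1 - p P2) * (if r = End_A2 then 1 else 0)"
  using outcome_prob_step[OF _ assms, of V2 r] by (simp add: nonterminals_def algebra_simps)

lemma expected_payoff_eq:
  "expected_payoff u p x i =
    u i End_A1 * outcome_prob p x End_A1 + u i End_A2 * outcome_prob p x End_A2 +
    u i Cycle * outcome_prob p x Cycle"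
proof -
  interpret prob_space "draws p" by (rule prob_space_draws)
  have sets: "{\<omega> \<in> space (draws p). outcome x \<omega> = r} \<in> sets (draws p)" for r
    using measurable_outcome by measurable
  let ?I = "\<lambda>r \<omega>. indicat_real {\<omega> \<in> space (draws p). outcome x \<omega> = r} \<omega>"
  have "expected_payoff u p x i = (\<integral>\<omega>. u i End_A1 * ?I End_A1 \<omega> +
      u i End_A2 * ?I End_A2 \<omega> + u i Cycle * ?I Cycle \<omega> \<partial>draws p)"
    unfolding expected_payoff_def
  proof (rule Bochner_Integration.integral_cong)
    fix \<omega> assume "\<omega> \<in> space (draws p)"
    then show "u i (outcome x \<omega>) = u i End_A1 * ?I End_A1 \<omega> +
      u i End_A2 * ?I End_A2 \<omega> + u i Cycle * ?I Cycle \<omega>"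
      by (cases "outcome x \<omega>") auto
  qed simp
  also have "\<dots> = u i End_A1 * prob {\<omega> \<in> space (draws p). outcome x \<omega> = End_A1} +
      u i End_A2 * prob {\<omega> \<in> space (draws p). outcome x \<omega> = End_A2} +
      u i Cycle * prob {\<omega> \<in> space (draws p). outcome x \<omega> = Cycle}"
    using sets by (simp add: emeasure_eq_measure)
  finally show ?thesis by (simp add: outcome_prob_def)
qed

lemma outcome_prob_sum:
  "outcome_prob p x End_A1 + outcome_prob p x End_A2 + outcome_prob p x Cycle = 1"
proof -
  interpret prob_space "draws p" by (rule prob_space_draws)
  have "expected_payoff (\<lambda>_ _. 1) p x P1 = 1"
    by (simp add: expected_payoff_def prob_space)
  then show ?thesis by (simp add: expected_payoff_eq)
qed

theorem outcome_distribution: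
  assumes "is_profile p" "\<not> (p P1 = 1 \<and> p P2 = 1)"
  shows "outcome_prob p V1 End_A1 = (1 - p P1) / (1 - p P1 * p P2)"
    and "outcome_prob p V1 End_A2 = p P1 * (1 - p P2) / (1 - p P1 * p P2)"
    and "outcome_prob p V1 Cycle = 0"
    and "outcome_prob p V2 End_A1 = p P2 * (1 - p P1) / (1 - p P1 * p P2)"
    and "outcome_prob p V2 End_A2 = (1 - p P2) / (1 - p P1 * p P2)"
    and "outcome_prob p V2 Cycle = 0"
proof -
  have p: "0 \<le> p P1" "p P1 \<le> 1" "0 \<le> p P2" "p P2 \<le> 1"
    using assms(1) by (auto simp: is_profile_def)
  have "p P1 * p P2 \<noteq> 1"
  proof
    assume "p P1 * p P2 = 1"
    moreover have "p P1 * p P2 \<le> p P1" "p P1 * p P2 \<le> p P2"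
      using p by (auto intro: mult_left_le mult_left_le_one_le)
    ultimately show False using p assms(2) by linarith
  qed
  then have nz: "1 - p P1 * p P2 \<noteq> 0" by simp
  note eqs = outcome_prob_V1[OF assms(1)] outcome_prob_V2[OF assms(1)]
  have solve: "a * (1 - s * t) = s * d + c"
    if "a = s * b + c" "b = t * a + d" for a b c d s t :: real
  proof -
    have "a = s * (t * a + d) + c" using that by simp
    then show ?thesis by (simp add: algebra_simps)
  qed
  note V1 = solve[OF eqs(1) eqs(2)]
  note V2 = solve[OF eqs(2) eqs(1)]
  show "outcome_prob p V1 End_A1 = (1 - p P1) / (1 - p P1 * p P2)"
    "outcome_prob p V1 End_A2 = p P1 * (1 - p P2) / (1 - p P1 * p P2)"
    "outcome_prob p V1 Cycle = 0"
    using V1[of End_A1] V1[of End_A2] V1[of Cycle] nz by (simp_all add: nonzero_eq_divide_eq)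
  show "outcome_prob p V2 End_A1 = p P2 * (1 - p P1) / (1 - p P1 * p P2)"
    "outcome_prob p V2 End_A2 = (1 - p P2) / (1 - p P1 * p P2)"
    "outcome_prob p V2 Cycle = 0"
    using V2[of End_A1] V2[of End_A2] V2[of Cycle] nz by (simp_all add: nonzero_eq_divide_eq mult.commute)
qed

theorem outcome_distribution_cycle:
  assumes "p P1 = 1" "p P2 = 1" "x \<in> nonterminals"
  shows "outcome_prob p x Cycle = 1"
proof -
  interpret prob_space "draws p" by (rule prob_space_draws)
  let ?D = "measure_pmf (pair_pmf (bernoulli_pmf (p P1)) (bernoulli_pmf (p P2)))"
  have "AE d in ?D. d = (True, True)"
  proof -
    have "b = True" if "b \<in> set_pmf (bernoulli_pmf 1)" for b
      using that by (cases b) (auto simp: set_pmf_iff)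
    then show ?thesis
      using assms(1,2) by (auto simp: AE_measure_pmf_iff)
  qed
  then have "AE \<omega> in draws p. stream_all (\<lambda>d. d = (True, True)) \<omega>"
    unfolding draws_def
    by (intro prob_space.AE_stream_all[OF measure_pmf.prob_space_axioms]) auto
  then have "AE \<omega> in draws p. outcome x \<omega> = Cycle"
  proof eventually_elim
    case (elim \<omega>)
    have "play x \<omega> n \<in> nonterminals" for n
    proof (induction n)
      case (Suc n)
      have "\<omega> !! n = (True, True)" using elim by (simp add: stream_all_def)
      with Suc show ?case by (auto simp: nonterminals_def)
    qed (use assms(3) in simp)
    then have "play x \<omega> n \<noteq> A1" "play x \<omega> n \<noteq> A2" for n
      by (metis nonterminals_def insertE singletonD position.distinct)+
    then show ?case by (simp add: outcome_def)
  qed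
  moreover have "{\<omega> \<in> space (draws p). outcome x \<omega> = Cycle} \<in> sets (draws p)"
    using measurable_outcome by measurable
  ultimately show ?thesis
    by (simp add: outcome_prob_def prob_Collect_eq_1)
qed

end

theory Submission
  imports Defs
begin

text \<open>
  Every profile invites a deviation. If both players always follow the cycle, player 2 stops. If
  only player 2 always follows it, the outcome is \<open>a\<^sub>1\<close>, and player 1 switches to the cycle. If
  player 2 stops with positive probability, then player 1, starting at \<open>v\<^sub>1\<close>, must stop at once;
  but against an immediately stopping player 1, player 2 does better, from \<open>v\<^sub>2\<close>, by following the
  cycle with certainty.
\<close>

text \<open>Conditioning on the first move. Unlike the closed-form distribution, this recursion also
  covers the profile where both players always follow the cycle.\<close>

lemma expected_payoff_V1:
  assumes "is_profile p"
  shows "expected_payoff u p V1 i = p P1 * expected_payoff u p V2 i + (1 - p P1) * u i End_A1"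
  by (simp add: expected_payoff_eq outcome_prob_V1[OF assms] algebra_simps)

lemma expected_payoff_V2:
  assumes "is_profile p"
  shows "expected_payoff u p V2 i = p P2 * expected_payoff u p V1 i + (1 - p P2) * u i End_A2"
  by (simp add: expected_payoff_eq outcome_prob_V2[OF assms] algebra_simps)

text \<open>Here the two recursions only say that the payoffs from \<open>V1\<close> and
  \<open>V2\<close> agree; the value comes from play being almost surely infinite.\<close>

lemma expected_payoff_cycle:
  assumes "p P1 = 1" "p P2 = 1" "x \<in> nonterminals"
  shows "expected_payoff u p x i = u i Cycle"
proof -
  have nonneg: "0 \<le> outcome_prob p x r" for r
    by (simp add: outcome_prob_def)
  have "outcome_prob p x Cycle = 1"
    using assms by (rule outcome_distribution_cycle)
  moreover from this have "outcome_prob p x End_A1 = 0" "outcome_prob p x End_A2 = 0"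
    using outcome_prob_sum[of p x] nonneg[of End_A1] nonneg[of End_A2] by linarith+
  ultimately show ?thesis
    by (simp add: expected_payoff_eq)
qed

lemma is_profile_upd:
  assumes "is_profile p" "q \<in> {0..1}"
  shows "is_profile (p(i := q))"
  using assms by (simp add: is_profile_def)

theorem proposition3:
  fixes u :: payoff
  assumes "u P1 Cycle > u P1 End_A1" and "u P1 End_A1 > u P1 End_A2"
    and "u P2 End_A1 > u P2 End_A2" and "u P2 End_A2 > u P2 Cycle"
  shows "\<not> (\<exists>p. uniform_Nash_equilibrium u p)"
proof
  assume "\<exists>p. uniform_Nash_equilibrium u p"
  then obtain p where p: "is_profile p"
    and opt: "\<And>x i q. x \<in> nonterminals \<Longrightarrow> q \<in> {0..1} \<Longrightarrow>
      expected_payoff u (p(i := q)) x i \<le> expected_payoff u p x i"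
    by (auto simp: uniform_Nash_equilibrium_def)
  have V: "V1 \<in> nonterminals" "V2 \<in> nonterminals"
    by (simp_all add: nonterminals_def)
  have bounds: "0 \<le> p P1" "p P1 \<le> 1" "0 \<le> p P2" "p P2 \<le> 1"
    using p by (auto simp: is_profile_def)
  define s t w where "s = p P1" and "t = p P2" and "w = expected_payoff u p V1 P1"
  \<comment> \<open>The payoff from \<open>V2\<close> is eliminated between the recursions, without
    dividing, as \<open>s * t = 1\<close> is still possible.\<close>
  have w: "w * (1 - s * t) = s * (1 - t) * u P1 End_A2 + (1 - s) * u P1 End_A1"
    using expected_payoff_V1[OF p, of u P1] expected_payoff_V2[OF p, of u P1]
    by (simp add: s_def t_def w_def algebra_simps)
  show False
  proof (cases "t = 1")
    case t: True
    show False
    proof (cases "s = 1")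
      case True
      have "expected_payoff u (p(P2 := 0)) V2 P2 = u P2 End_A2"
        using expected_payoff_V2[OF is_profile_upd[OF p, of 0 P2], of u P2] by simp
      moreover have "expected_payoff u p V2 P2 = u P2 Cycle"
        using True t V by (intro expected_payoff_cycle) (simp_all add: s_def t_def)
      ultimately show False
        using opt[OF V(2), of 0 P2] assms(4) by simp
    next
      case False
      \<comment> \<open>For \<open>t = 1\<close> both sides of \<open>w\<close> carry the nonzero
        factor \<open>1 - s\<close>.\<close>
      then have "w = u P1 End_A1"
        using w t by simp
      moreover have "expected_payoff u (p(P1 := 1)) V1 P1 = u P1 Cycle"
        using t V by (intro expected_payoff_cycle) (simp_all add: t_def)
      ultimately show False
        using opt[OF V(1), of 1 P1] assms(1) by (simp add: w_def)
    qed
  next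
    case False
    then have t: "t < 1"
      using bounds by (simp add: t_def)
    have "expected_payoff u (p(P1 := 0)) V1 P1 = u P1 End_A1"
      using expected_payoff_V1[OF is_profile_upd[OF p, of 0 P1], of u P1] by simp
    then have "u P1 End_A1 \<le> w"
      using opt[OF V(1), of 0 P1] by (simp add: w_def)
    moreover have "s * t \<le> 1"
      using bounds by (simp add: s_def t_def mult_le_one)
    ultimately have "u P1 End_A1 * (1 - s * t) \<le> w * (1 - s * t)"
      by (intro mult_right_mono) simp_all
    \<comment> \<open>Uses \<open>(1 - s * t) - (1 - s) = s * (1 - t)\<close>.\<close>
    then have "s * ((1 - t) * (u P1 End_A1 - u P1 End_A2)) \<le> 0"
      unfolding w by (simp add: algebra_simps)
    moreover have "0 < (1 - t) * (u P1 End_A1 - u P1 End_A2)"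
      using t assms(2) by simp
    ultimately have "s = 0"
      using bounds(1) t assms(2) by (auto simp: s_def mult_le_0_iff)
    \<comment> \<open>Since player 1 stops at once, the payoff from \<open>V1\<close> is
      \<open>u P2 End_A1\<close> for every \<open>q\<close>.\<close>
    then have P2: "expected_payoff u (p(P2 := q)) V2 P2 = q * u P2 End_A1 + (1 - q) * u P2 End_A2"
      if "q \<in> {0..1}" for q
      using expected_payoff_V1[OF is_profile_upd[OF p that, of P2], of u P2]
        expected_payoff_V2[OF is_profile_upd[OF p that, of P2], of u P2]
      by (simp add: s_def)
    \<comment> \<open>The choice \<open>q = t\<close> gives back \<open>p\<close> itself,
      \<open>q = 1\<close> the deviation.\<close>
    have "u P2 End_A1 \<le> t * u P2 End_A1 + (1 - t) * u P2 End_A2"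
      using opt[OF V(2), of 1 P2] P2[of 1] P2[of t] bounds by (simp add: t_def)
    then have "(1 - t) * (u P2 End_A1 - u P2 End_A2) \<le> 0"
      by (simp add: algebra_simps)
    then show False
      using t assms(3) by (simp add: mult_le_0_iff)
  qed
qed

end
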